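(* Let $d\ge 1$, let $v=(0,\ldots,0,1)\in\mathbb{R}^{d+1}$ and let $s\in\mathbb{R}_{>0}$. For arbitrary $p\in\mathcal{S}_d$ and $b\in(-1,1)$ with $b+p_{d+1}>0$, the image under $S^{-1}(\cdot,v,s)$ of the hyperspherical cap $C(p,b)$ is a hyperball $B(c,r)$ in $\mathbb{R}^d$. The center and radius of the hyperball are $$c=S^{-1}\left(\frac{p-\alpha v}{\|p-\alpha v\|},v,s\right),\qquad r=s\sqrt{\frac{2\alpha}{b+p_{d+1}}},\qquad\text{where } \alpha:=\frac{1-b^2}{2(b+p_{d+1})}.$$
   Context: $\mathcal{S}_d=\{x\in\mathbb{R}^{d+1}:\|x\|=1\}$ is the unit sphere in $\mathbb{R}^{d+1}$, $\|\cdot\|$ is the Euclidean norm, and $\langle\cdot,\cdot\rangle$ is the standard inner product. For a vector $z\in\mathbb{R}^{d+1}$, $z_{1,\ldots,d}\in\mathbb{R}^d$ denotes its first $d$ coordinates and $z_{d+1}$ its last coordinate. For a unit vector $v\in\mathbb{R}^{d+1}$ and $s>0$, the (un)embedding map is defined for $Y\in\mathcal{S}_d\setminus\{-v\}$ by $$S^{-1}(Y,v,s)=2s\left(\frac{Y+v}{\|Y+v\|^2}\right)_{1,\ldots,d}\in\mathbb{R}^d .$$ For $v=(0,\ldots,0,1)$ this equals $s\,\frac{Y_{1,\ldots,d}}{1+Y_{d+1}}$, and it is the inverse of the embedding $S(x,v,s)=2s\frac{[x,s]}{\|x\|^2+s^2}-v$, $x\in\mathbb{R}^d$, where $[x,s]\in\mathbb{R}^{d+1}$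 is $x$ extended by the last coordinate $s$. The (open) hyperspherical cap with unit direction $p\in\mathcal{S}_d$ and bias $b\in(-1,1)$ is $C(p,b)=\{x\in\mathcal{S}_d:\langle x,p\rangle>b\}$. The (open) hyperball with center $c\in\mathbb{R}^d$ and radius $r>0$ is $B(c,r)=\{x\in\mathbb{R}^d:\|x-c\|<r\}$. *)

theory Defs
  imports "HOL-Analysis.Analysis"
begin

text \<open>
  With \<open>d = CARD('n)\<close>, the space of dimension \<open>d + 1\<close> is the product \<open>real ^ 'n \<times> real\<close>:
  \<open>fst z\<close> holds the first \<open>d\<close> coordinates of \<open>z\<close> and \<open>snd z\<close> the last one. The library's inner
  product and norm on this type are the standard Euclidean ones.
\<close>

text \<open>
  Meaningful only for \<open>Y \<noteq> - v\<close>; at \<open>Y = - v\<close> the inverse of zero yields the junk value \<open>0\<close>.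
\<close>

definition unembed ::
  "(real ^ 'n) \<times> real \<Rightarrow> (real ^ 'n) \<times> real \<Rightarrow> real \<Rightarrow> real ^ 'n"
  where "unembed Y v s = (2 * s) *\<^sub>R fst ((Y + v) /\<^sub>R (norm (Y + v))\<^sup>2)"

definition hcap :: "(real ^ 'n) \<times> real \<Rightarrow> real \<Rightarrow> ((real ^ 'n) \<times> real) set"
  where "hcap p b = {x \<in> sphere 0 1. x \<bullet> p > b}"

end

theory Submission
  imports Defs
begin

text \<open>
  Writing \<open>p = (q, t)\<close> and \<open>x\<close> for the image of a unit vector \<open>Y\<close>, the difference
  \<open>(norm (x - s q / (b + t)))\<^sup>2 - s\<^sup>2 (1 - b\<^sup>2) / (b + t)\<^sup>2\<close> is a positive multiple of
  \<open>b - Y \<bullet> p\<close>, so the cap is exactly the preimage of the ball with center \<open>s q / (b + t)\<close> and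
  radius \<open>s sqrt (1 - b\<^sup>2) / (b + t)\<close>. The stated center agrees with this one because the choice of
  \<open>\<alpha>\<close> makes \<open>norm (p - \<alpha> v) = b + \<alpha>\<close>.
\<close>

lemma sphere_prod_iff:
  fixes y :: "real ^ 'n"
  shows "(y, h) \<in> sphere 0 (1::real) \<longleftrightarrow> y \<bullet> y + h\<^sup>2 = 1"
  by (auto simp: norm_eq_sqrt_inner inner_prod_def power2_eq_square)

text \<open>For a unit vector the squared norm of \<open>Y + v\<close> is the linear expression
  \<open>2 * (1 + h)\<close>, so the map is a scaled stereographic projection from the pole
  \<open>- v\<close>, the only unit vector with \<open>h = - 1\<close>.\<close>

lemma unembed_unit:
  fixes y :: "real ^ 'n"
  assumes "(y, h) \<in> sphere 0 1" and "h \<noteq> - 1"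
  shows "unembed (y, h) (0, 1) s = (s / (1 + h)) *\<^sub>R y"
proof -
  have "y \<bullet> y + h\<^sup>2 = 1"
    using assms(1) by (simp only: sphere_prod_iff)
  then have "(norm ((y, h) + (0, 1)))\<^sup>2 = 2 * (1 + h)"
    unfolding power2_norm_eq_inner by (simp add: inner_prod_def algebra_simps power2_eq_square)
  moreover have "(2 * s) * inverse (2 * (1 + h)) = s / (1 + h)"
    using assms(2) by (simp add: divide_simps)
  ultimately show ?thesis
    unfolding unembed_def by (metis add.right_neutral add_Pair fst_conv fst_scaleR scaleR_scaleR)
qed

lemma sphere_last_gt:
  fixes y :: "real ^ 'n" and h :: real
  assumes "(y, h) \<in> sphere 0 1" and "h \<noteq> - 1"
  shows "- 1 < h"
proof -
  have "h\<^sup>2 \<le> 1"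
    using assms(1) inner_ge_zero[of y] unfolding sphere_prod_iff by linarith
  then show ?thesis
    using assms(2) by (auto simp: abs_square_le_1)
qed

text \<open>The witness is the embedding S(x, v, s) = 2 s [x, s] / D - v, where D is the squared
  norm of [x, s].\<close>

lemma unembed_surj:
  fixes x :: "real ^ 'n"
  assumes "s > 0"
  obtains y h where "(y, h) \<in> sphere 0 (1::real)" "h \<noteq> - 1" "unembed (y, h) (0, 1) s = x"
proof -
  define D where "D = x \<bullet> x + s\<^sup>2"
  define y where "y = (2 * s / D) *\<^sub>R x"
  define h where "h = 2 * s\<^sup>2 / D - 1"
  have D: "D > 0"
    using assms by (simp add: D_def add_nonneg_pos)
  have "y \<bullet> y = 4 * s\<^sup>2 * (D - s\<^sup>2) / D\<^sup>2"
    by (simp add: y_def D_def power2_eq_square)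
  also have "\<dots> = 1 - h\<^sup>2"
    using D by (simp add: h_def field_simps power2_eq_square)
  finally have unit: "(y, h) \<in> sphere 0 (1::real)"
    unfolding sphere_prod_iff by simp
  have ne: "h \<noteq> - 1"
    using D assms by (simp add: h_def)
  have "(s / (1 + h)) *\<^sub>R y = x"
    using D assms by (simp add: h_def y_def power2_eq_square)
  then show ?thesis
    using that[OF unit ne] unembed_unit[OF unit ne] by simp
qed

text \<open>Covers every unit vector other than \<open>- v\<close>, inside the cap or not, so that
  both inclusions between image and ball follow from it.\<close>

lemma hcap_iff_unembed_in_ball:
  fixes y q :: "real ^ 'n"
  assumes Y: "(y, h) \<in> sphere 0 (1::real)" and ne: "h \<noteq> - 1"
    and p: "(q, t) \<in> sphere 0 (1::real)" and k: "b + t > 0" and s: "s > 0"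
  shows "b < (y, h) \<bullet> (q, t) \<longleftrightarrow>
    (norm (unembed (y, h) (0, 1) s - (s / (b + t)) *\<^sub>R q))\<^sup>2 < s\<^sup>2 * (1 - b\<^sup>2) / (b + t)\<^sup>2"
    (is "_ \<longleftrightarrow> ?L < ?R")
proof -
  have h: "1 + h > 0"
    using sphere_last_gt[OF Y ne] by simp
  \<comment> \<open>The factored form cancels one factor \<open>1 + h\<close>, which makes the
    numerator affine in \<open>(y, h)\<close>.\<close>
  have yy: "y \<bullet> y = (1 - h) * (1 + h)" and qq: "q \<bullet> q = 1 - t\<^sup>2"
    using Y p unfolding sphere_prod_iff by (simp_all add: algebra_simps power2_eq_square)
  have "?L = (s / (1 + h))\<^sup>2 * (y \<bullet> y) - 2 * (s / (1 + h)) * (s / (b + t)) * (y \<bullet> q)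
      + (s / (b + t))\<^sup>2 * (q \<bullet> q)"
    unfolding unembed_unit[OF Y ne] power2_norm_eq_inner
    by (simp add: inner_diff inner_commute power2_eq_square)
  also have "\<dots> = s\<^sup>2 * ((1 - h) / (1 + h) - 2 * (y \<bullet> q) / ((1 + h) * (b + t))
      + (1 - t\<^sup>2) / (b + t)\<^sup>2)"
    unfolding yy qq using h k by (simp add: divide_simps) (simp add: algebra_simps power2_eq_square)
  \<comment> \<open>The constant terms merge to \<open>(b\<^sup>2 - t\<^sup>2) / (b + t)\<^sup>2 =
    (b - t) / (b + t)\<close>, which leaves a single factor \<open>b + t\<close> in the
    denominator.\<close>
  finally have "?L - ?R = 2 * s\<^sup>2 / ((1 + h) * (b + t)) * (b - (y, h) \<bullet> (q, t))"
    using h k by (simp add: divide_simps) (simp add: algebra_simps power2_eq_square)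
  moreover have "2 * s\<^sup>2 / ((1 + h) * (b + t)) > 0"
    using h k s by simp
  ultimately have "?L - ?R < 0 \<longleftrightarrow> b - (y, h) \<bullet> (q, t) < 0"
    by (metis mult_less_0_iff not_less_iff_gr_or_eq)
  then show ?thesis
    by linarith
qed

theorem theorem1:
  fixes p v :: "(real ^ 'n) \<times> real"
    and c :: "real ^ 'n"
    and b s \<alpha> r :: real
  assumes "v = (0, 1)"
    and "s > 0"
    and "p \<in> sphere 0 1"
    and "b \<in> {-1<..<1}"
    and "b + snd p > 0"
    and "\<alpha> = (1 - b\<^sup>2) / (2 * (b + snd p))"
    and "c = unembed ((p - \<alpha> *\<^sub>R v) /\<^sub>R norm (p - \<alpha> *\<^sub>R v)) v s"
    and "r = s * sqrt (2 * \<alpha> / (b + snd p))"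
  shows "hcap p b \<subseteq> sphere 0 1 - {- v} \<and>
    p - \<alpha> *\<^sub>R v \<noteq> 0 \<and>
    (p - \<alpha> *\<^sub>R v) /\<^sub>R norm (p - \<alpha> *\<^sub>R v) \<in> sphere 0 1 - {- v} \<and>
    r > 0 \<and>
    (\<lambda>Y. unembed Y v s) ` hcap p b = ball c r"
proof -
  obtain q t where p: "p = (q, t)"
    by (cases p)
  note v = assms(1) and s = assms(2) and \<alpha> = assms(6)
  have P: "(q, t) \<in> sphere 0 (1::real)" and k: "b + t > 0" and b: "- 1 < b" "b < 1"
    using assms(3-5) by (simp_all add: p)
  have b2: "1 - b\<^sup>2 > 0"
    using b by (simp add: abs_square_less_1 abs_less_iff)
  have qq: "q \<bullet> q + t\<^sup>2 = 1"
    using P unfolding sphere_prod_iff .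
  have \<alpha>k: "2 * \<alpha> * (b + t) = 1 - b\<^sup>2"
    using k unfolding \<alpha> p by (simp add: field_simps)
  have w: "p - \<alpha> *\<^sub>R v = (q, t - \<alpha>)"
    by (simp add: p v)
  \<comment> \<open>Positivity of \<open>b + \<alpha>\<close> selects the right square root when the
    norm is read off from its square below.\<close>
  have "2 * (b + t) * (b + \<alpha>) = (1 - t\<^sup>2) + (b + t)\<^sup>2"
    using \<alpha>k by (simp add: algebra_simps power2_eq_square)
  also have "\<dots> > 0"
    using qq k inner_ge_zero[of q] by (smt (verit) zero_less_power)
  finally have b\<alpha>: "b + \<alpha> > 0"
    using k by (simp add: zero_less_mult_iff)
  \<comment> \<open>The left side is \<open>1 - 2 * t * \<alpha> + \<alpha>\<^sup>2\<close>, so the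
    equation amounts to \<open>\<alpha>k\<close>.\<close>
  have "(norm (q, t - \<alpha>))\<^sup>2 = (b + \<alpha>)\<^sup>2"
    using qq \<alpha>k unfolding power2_norm_eq_inner
    by (simp add: inner_prod_def algebra_simps power2_eq_square)
  then have N: "norm (q, t - \<alpha>) = b + \<alpha>"
    using b\<alpha> by (simp add: power2_eq_iff_nonneg)
  define u where "u = (p - \<alpha> *\<^sub>R v) /\<^sub>R norm (p - \<alpha> *\<^sub>R v)"
  have w0: "p - \<alpha> *\<^sub>R v \<noteq> 0"
    using N b\<alpha> w by (metis norm_zero less_irrefl)
  have u: "u = (q /\<^sub>R (b + \<alpha>), (t - \<alpha>) / (b + \<alpha>))"
    by (simp add: u_def w N divide_inverse mult.commute)
  have "norm u = 1"
    using w0 by (simp add: u_def)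
  then have U: "(q /\<^sub>R (b + \<alpha>), (t - \<alpha>) / (b + \<alpha>)) \<in> sphere 0 (1::real)"
    by (simp add: u)
  \<comment> \<open>The normalizing factor \<open>b + \<alpha>\<close> thus cancels against that of
    \<open>q\<close> when \<open>u\<close> is projected.\<close>
  have h1: "1 + (t - \<alpha>) / (b + \<alpha>) = (b + t) / (b + \<alpha>)"
    using b\<alpha> by (simp add: field_simps)
  then have une: "(t - \<alpha>) / (b + \<alpha>) \<noteq> - 1"
    using k b\<alpha> by (smt (verit) divide_pos_pos)
  have c: "c = (s / (b + t)) *\<^sub>R q"
    using b\<alpha> unembed_unit[OF U une, of s] unfolding assms(7) u_def[symmetric]
    unfolding u v h1 by simp
  have "\<alpha> > 0"
    using \<alpha>k b2 k by (metis zero_less_mult_iff zero_less_numeral less_asym)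
  then have r: "r > 0"
    using s k by (simp add: assms(8) p)
  have "2 * \<alpha> / (b + t) = (1 - b\<^sup>2) / (b + t)\<^sup>2"
    using k unfolding \<alpha>k[symmetric] by (simp add: power2_eq_square)
  then have r2: "r\<^sup>2 = s\<^sup>2 * (1 - b\<^sup>2) / (b + t)\<^sup>2"
    using b2 by (simp add: assms(8) p power_mult_distrib)
  have ball_iff: "x \<in> ball c r \<longleftrightarrow> (norm (x - c))\<^sup>2 < r\<^sup>2" for x
    using r power_strict_mono[of "norm (x - c)" r 2] power2_less_imp_less[of "norm (x - c)" r]
    by (auto simp: dist_norm norm_minus_commute)
  \<comment> \<open>Since \<open>- v \<bullet> p = - t\<close>, the assumption
    \<open>b + t > 0\<close> says that the pole lies outside the cap.\<close>
  have cap_ne: "h \<noteq> - 1" if "(y, h) \<in> hcap p b" for y h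
  proof
    assume "h = - 1"
    have "(y, h) \<in> sphere 0 (1::real)" and "b < (y, h) \<bullet> (q, t)"
      using that by (simp_all add: hcap_def p)
    then have "y = 0" "b < (y, h) \<bullet> (q, t)"
      using \<open>h = - 1\<close> unfolding sphere_prod_iff by simp_all
    then show False
      using k \<open>h = - 1\<close> by simp
  qed
  have cap_iff: "(y, h) \<in> hcap p b \<longleftrightarrow> unembed (y, h) v s \<in> ball c r"
    if "(y, h) \<in> sphere 0 (1::real)" "h \<noteq> - 1" for y h
    using hcap_iff_unembed_in_ball[OF that P k s] that(1)
    unfolding ball_iff r2 unfolding v c hcap_def p by simp
  have "(\<lambda>Y. unembed Y v s) ` hcap p b = ball c r"
  proof (intro equalityI subsetI)
    fix x assume "x \<in> (\<lambda>Y. unembed Y v s) ` hcap p b"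
    then obtain y h where yh: "(y, h) \<in> hcap p b" "x = unembed (y, h) v s"
      by auto
    then have "(y, h) \<in> sphere 0 (1::real)"
      by (simp add: hcap_def)
    then show "x \<in> ball c r"
      using cap_iff cap_ne yh by blast
  next
    fix x assume x: "x \<in> ball c r"
    \<comment> \<open>Any preimage of \<open>x\<close> on the sphere will do: \<open>cap_iff\<close>
      forces it into the cap.\<close>
    obtain y h where "(y, h) \<in> sphere 0 (1::real)" "h \<noteq> - 1" "unembed (y, h) (0, 1) s = x"
      using unembed_surj[OF s] by blast
    then show "x \<in> (\<lambda>Y. unembed Y v s) ` hcap p b"
      using cap_iff x v by blast
  qed
  moreover have "hcap p b \<subseteq> sphere 0 1 - {- v}"
    using cap_ne by (auto simp: hcap_def v)
  moreover have "u \<in> sphere 0 1 - {- v}"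
    using \<open>norm u = 1\<close> une by (auto simp: u v)
  ultimately show ?thesis
    using w0 r by (simp add: u_def)
qed

end
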